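(* Let $\eta_l<\eta_r$ be real numbers and let $F\in C^3(\mathbb{R})$ satisfy $F'(\eta_l)=F'(\eta_r)=0$, $F''(\eta_l)>0$ and $F''(\eta_r)>0$. Let $c\in\mathbb{R}$ and let $\eta\in C^2(\mathbb{R})$ be an increasing function with $\eta'>0$ such that $$-|\partial_x|\eta(x)+c\,\eta'(x)=F'(\eta(x))\quad\text{for all }x\in\mathbb{R},\qquad \lim_{x\to-\infty}\eta(x)=\eta_l,\qquad \lim_{x\to+\infty}\eta(x)=\eta_r.$$ Assume moreover that there exist constants $B>A>0$ such that $A|x|^{-2}\le \eta'(x)\le B|x|^{-2}$ for all $|x|\ge 1$. Then $$c=\frac{1}{\eta_r-\eta_l}\lim_{R\to+\infty}\int_{-R}^{R}F'(\eta(x))\,dx .$$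
   Context: The operator $|\partial_x|$ (also written $(-\Delta)^{1/2}$) is the operator with Fourier symbol $|k|$. For $u\in L^\infty(\mathbb{R})\cap C^2(\mathbb{R})$ it is given by $$|\partial_x|u(x)=-\frac1\pi\int_0^{+\infty}\frac{u(x+y)-2u(x)+u(x-y)}{y^2}\,dy .$$ *)

theory Defs
  imports "HOL-Analysis.Analysis"
begin

definition Ck :: "nat \<Rightarrow> (real \<Rightarrow> real) \<Rightarrow> bool" where
  "Ck k f \<longleftrightarrow>
     (\<forall>j<k. \<forall>x. (deriv ^^ j) f field_differentiable (at x)) \<and>
     continuous_on UNIV ((deriv ^^ k) f)"

text \<open>
  The operator with Fourier symbol \<open>\<bar>k\<bar>\<close>, in its singular-integral form for bounded \<open>C\<^sup>2\<close>
  functions. For such functions the integrand is Lebesgue integrable on \<open>{0<..}\<close>: it is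
  bounded near \<open>0\<close> because of the second difference, and \<open>O(y powi (-2))\<close> at infinity. Outside
  this class the value is not meaningful.
\<close>

definition abs_deriv :: "(real \<Rightarrow> real) \<Rightarrow> real \<Rightarrow> real" where
  "abs_deriv u x = - (1 / pi) * (LBINT y:{0<..}. (u (x + y) - 2 * u x + u (x - y)) / y\<^sup>2)"

end

theory Submission
  imports Defs "HOL-Real_Asymp.Real_Asymp"
begin

text \<open>
  Integrating the equation over \<open>[-R, R]\<close>, it suffices that the integral of \<open>\<bar>\<partial>\<^sub>x\<bar>\<eta>\<close> over
  \<open>[-R, R]\<close> vanishes as \<open>R\<close> grows. Let \<open>\<Phi>' = \<eta>\<close>. By Fubini, up to the factor \<open>-1/\<pi>\<close> this
  integral is that of \<open>G\<^sub>R(y) / y\<^sup>2\<close> over \<open>y > 0\<close>, where \<open>G\<^sub>R(y)\<close> is the second difference of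
  \<open>\<Phi>\<close> with step \<open>y\<close> at \<open>R\<close> minus the one at \<open>-R\<close>. For \<open>y < R/2\<close>, the bound
  \<open>\<eta>' = O(R powr -2)\<close> on the relevant interval gives \<open>G\<^sub>R(y) = O(y\<^sup>2 / R\<^sup>2)\<close>. For \<open>y \<ge> R/2\<close>,
  the decay of \<open>\<eta>'\<close> makes \<open>\<Phi>\<close> piecewise linear up to \<open>O(sqrt (1 + \<bar>x\<bar>))\<close>; the linear parts
  cancel in \<open>G\<^sub>R\<close>, so \<open>G\<^sub>R(y) = O(sqrt y)\<close>. Hence the integral is \<open>O(1/R + 1/sqrt R)\<close>.
\<close>

section \<open>Growth estimates from derivative bounds\<close>

text \<open>In the step \<open>t\<close>, the second difference has derivative
  \<open>g (x + t) - g (x - t)\<close>, which the mean value theorem bounds by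
  \<open>2 * t * S\<close>, the derivative of \<open>S * t^2\<close>. Both vanish at
  \<open>t = 0\<close>.\<close>

lemma second_difference_le:
  fixes f g h :: "real \<Rightarrow> real"
  assumes f: "\<And>x. (f has_real_derivative g x) (at x)"
    and g: "\<And>x. (g has_real_derivative h x) (at x)"
    and y: "0 \<le> y"
    and S: "\<And>t. x - y \<le> t \<Longrightarrow> t \<le> x + y \<Longrightarrow> \<bar>h t\<bar> \<le> S"
  shows "\<bar>f (x + y) - 2 * f x + f (x - y)\<bar> \<le> S * y\<^sup>2"
proof -
  have g_diff: "\<bar>g (x + t) - g (x - t)\<bar> \<le> 2 * t * S" if t: "0 \<le> t" "t \<le> y" for t
  proof (cases "t = 0")
    case False
    then have "x - t < x + t" using t by simp
    from MVT2[OF this, of g h] g obtain z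
      where z: "x - t < z" "z < x + t" "g (x + t) - g (x - t) = 2 * t * h z"
      by auto
    have "\<bar>h z\<bar> \<le> S" using z t by (intro S) auto
    then show ?thesis using z(3) t by (simp add: abs_mult mult_left_mono)
  qed simp
  \<comment> \<open>The sign \<open>s\<close> treats both halves of the absolute value at once; it
    is set to 1 and -1 at the end.\<close>
  have "0 \<le> S * y\<^sup>2 - s * (f (x + y) - 2 * f x + f (x - y))" if s: "\<bar>s\<bar> = 1" for s :: real
  proof -
    define D where "D = (\<lambda>t. S * t\<^sup>2 - s * (f (x + t) - 2 * f x + f (x - t)))"
    have "D 0 \<le> D y"
    proof (rule DERIV_nonneg_imp_nondecreasing[OF y])
      fix t assume t: "0 \<le> t" "t \<le> y"
      have "(D has_real_derivative (2 * t * S - s * (g (x + t) - g (x - t)))) (at t)"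
        unfolding D_def
        by (auto intro!: derivative_eq_intros DERIV_chain2[OF f] simp: algebra_simps)
      moreover have "s * (g (x + t) - g (x - t)) \<le> \<bar>g (x + t) - g (x - t)\<bar>"
        using abs_ge_self[of "s * (g (x + t) - g (x - t))"] s by (simp add: abs_mult)
      ultimately show "\<exists>d. (D has_real_derivative d) (at t) \<and> 0 \<le> d"
        using g_diff[OF t] by force
    qed
    then show ?thesis by (simp add: D_def)
  qed
  from this[of 1] this[of "-1"] show ?thesis by simp
qed

text \<open>On \<open>t >= 1\<close> the function \<open>g t + B / t\<close> is nonincreasing, so
  its value at \<open>x\<close> is at least its limit \<open>a\<close>.\<close>

lemma tail_le_inverse:
  fixes g g' :: "real \<Rightarrow> real"
  assumes g: "\<And>x. (g has_real_derivative g' x) (at x)"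
    and le: "\<And>x. x \<ge> 1 \<Longrightarrow> g' x \<le> B / x\<^sup>2"
    and lim: "(g \<longlongrightarrow> a) at_top" and x: "1 \<le> x"
  shows "a - g x \<le> B / x"
proof -
  have "g z + B / z \<le> g x + B / x" if z: "x \<le> z" for z
  proof (rule DERIV_nonpos_imp_nonincreasing[OF z])
    fix t assume t: "x \<le> t" "t \<le> z"
    have "((\<lambda>t. g t + B / t) has_real_derivative (g' t - B / t\<^sup>2)) (at t)"
      using t x by (auto intro!: derivative_eq_intros g simp: power2_eq_square field_simps)
    then show "\<exists>d. ((\<lambda>t. g t + B / t) has_real_derivative d) (at t) \<and> d \<le> 0"
      using le[of t] t x by force
  qed
  then have "eventually (\<lambda>z. g z + B / z \<le> g x + B / x) at_top"
    using eventually_ge_at_top by (rule eventually_mono[rotated])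
  moreover have "((\<lambda>z. g z + B / z) \<longlongrightarrow> a + 0) at_top"
    by (intro tendsto_add lim tendsto_divide_0[OF tendsto_const]
        filterlim_at_top_imp_at_infinity filterlim_ident)
  ultimately have "a + 0 \<le> g x + B / x"
    by (intro tendsto_upperbound) auto
  then show ?thesis by simp
qed

text \<open>The derivative of \<open>2 * K * sqrt (1 + t)\<close> is
  \<open>K / sqrt (1 + t)\<close>, which dominates the derivative \<open>g t - a\<close> of the
  error in absolute value. At \<open>t = 0\<close> the error is 0 and the bound is
  \<open>2 * K >= 0\<close>.\<close>

lemma antiderivative_asymptotics:
  fixes f g :: "real \<Rightarrow> real"
  assumes f: "\<And>x. (f has_real_derivative g x) (at x)"
    and le: "\<And>x. x \<ge> 0 \<Longrightarrow> \<bar>g x - a\<bar> \<le> K / sqrt (1 + x)" and x: "0 \<le> x"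
  shows "\<bar>f x - f 0 - a * x\<bar> \<le> 2 * K * sqrt (1 + x)"
proof -
  have K: "0 \<le> K" using le[of 0] by simp
  have "0 \<le> 2 * K * sqrt (1 + x) - s * (f x - f 0 - a * x)" if s: "\<bar>s\<bar> = 1" for s :: real
  proof -
    define D where "D = (\<lambda>t. 2 * K * sqrt (1 + t) - s * (f t - f 0 - a * t))"
    have "D 0 \<le> D x"
    proof (rule DERIV_nonneg_imp_nondecreasing[OF x])
      fix t assume t: "0 \<le> t" "t \<le> x"
      have "(D has_real_derivative (K / sqrt (1 + t) - s * (g t - a))) (at t)"
        unfolding D_def using t by (auto intro!: derivative_eq_intros f simp: field_simps)
      moreover have "s * (g t - a) \<le> \<bar>g t - a\<bar>"
        using abs_ge_self[of "s * (g t - a)"] s by (simp add: abs_mult)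
      ultimately show "\<exists>d. (D has_real_derivative d) (at t) \<and> 0 \<le> d"
        using le[OF t(1)] by force
    qed
    with K show ?thesis by (simp add: D_def)
  qed
  from this[of 1] this[of "-1"] show ?thesis by simp
qed

lemma antiderivative_exists:
  fixes g :: "real \<Rightarrow> real"
  assumes "continuous_on UNIV g"
  obtains f where "\<And>x. (f has_real_derivative g x) (at x)"
proof -
  have "\<exists>f. \<forall>x::real. -\<infinity> < ereal x \<longrightarrow> ereal x < \<infinity> \<longrightarrow> (f has_vector_derivative g x) (at x)"
    by (rule einterval_antiderivative)
      (use assms in \<open>auto simp: continuous_on_eq_continuous_at\<close>)
  then show ?thesis
    using that by (auto simp: has_real_derivative_iff_has_vector_derivative)
qed

section \<open>Integrals of the dominating functions\<close>

lemma has_bochner_integral_powr_tail: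
  fixes a r :: real
  assumes a: "0 < a" and r: "1 < r"
  shows "has_bochner_integral lborel (\<lambda>y. y powr (-r) * indicator {a..} y)
    (a powr (1 - r) / (r - 1))"
proof (rule has_bochner_integral_nn_integral)
  have "((\<lambda>y. - (y powr (1 - r) / (r - 1))) \<longlongrightarrow> - (0 / (r - 1))) at_top"
    using r by (intro tendsto_intros tendsto_neg_powr filterlim_ident) auto
  then have "(\<integral>\<^sup>+y. ennreal (y powr (-r)) * indicator {a..} y \<partial>lborel)
      = ennreal (- (0 / (r - 1)) - (- (a powr (1 - r) / (r - 1))))"
  proof (intro nn_integral_FTC_atLeast)
    fix x assume "a \<le> x"
    then have "((\<lambda>y. - (y powr (1 - r) / (r - 1))) has_real_derivative
        - ((1 - r) * x powr (1 - r - 1) / (r - 1))) (at x)"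
      using a r by (auto intro!: derivative_eq_intros)
    moreover have "- ((1 - r) * x powr (1 - r - 1) / (r - 1)) = x powr (- r)"
      using r by (simp add: divide_simps) (simp add: algebra_simps)
    ultimately show "((\<lambda>y. - (y powr (1 - r) / (r - 1))) has_real_derivative x powr (- r)) (at x)"
      by simp
  qed (use r in auto)
  then show "(\<integral>\<^sup>+y. ennreal (y powr (-r) * indicator {a..} y) \<partial>lborel)
      = ennreal (a powr (1 - r) / (r - 1))"
    by (simp add: ennreal_mult'' ennreal_indicator)
qed (use r in auto)

text \<open>The shape of both majorants below: constant near 0, where a second difference absorbs
  the factor \<open>1 / y^2\<close>, and a power at infinity. It serves with \<open>r = 2\<close>
  for Fubini and with \<open>r = 3 / 2\<close> for the final estimate.\<close>

lemma has_bochner_integral_const_powr_tail: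
  fixes a b d r :: real
  assumes d: "0 < d" and r: "1 < r"
  shows "has_bochner_integral lborel
    (\<lambda>y. a * indicator {0<..<d} y + b * (y powr (-r) * indicator {d..} y))
    (a * d + b * (d powr (1 - r) / (r - 1)))"
proof -
  have "has_bochner_integral lborel (indicator {0<..<d} :: real \<Rightarrow> real)
      (measure lborel {0<..<d})"
    using d by (intro has_bochner_integral_real_indicator) auto
  then show ?thesis
    using d by (intro has_bochner_integral_add has_bochner_integral_mult_right
        has_bochner_integral_powr_tail r) simp_all
qed

section \<open>Monotone fronts and their distance to the limits\<close>

locale front =
  fixes \<eta> \<eta>' \<eta>'' :: "real \<Rightarrow> real" and \<eta>l \<eta>r B :: real
  assumes deriv1: "\<And>x. (\<eta> has_real_derivative \<eta>' x) (at x)"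
    and deriv2: "\<And>x. (\<eta>' has_real_derivative \<eta>'' x) (at x)"
    and cont2: "continuous_on UNIV \<eta>''"
    and nonneg: "\<And>x. 0 \<le> \<eta>' x"
    and decay: "\<And>x. \<bar>x\<bar> \<ge> 1 \<Longrightarrow> \<eta>' x \<le> B / x\<^sup>2"
    and lim_bot: "(\<eta> \<longlongrightarrow> \<eta>l) at_bot"
    and lim_top: "(\<eta> \<longlongrightarrow> \<eta>r) at_top"
begin

lemma mono: "x \<le> y \<Longrightarrow> \<eta> x \<le> \<eta> y"
  by (rule DERIV_nonneg_imp_nondecreasing) (use deriv1 nonneg in auto)

lemma bounds: "\<eta>l \<le> \<eta> x" "\<eta> x \<le> \<eta>r"
proof -
  show "\<eta> x \<le> \<eta>r"
    by (rule tendsto_lowerbound[OF lim_top])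
      (auto intro: eventually_mono[OF eventually_ge_at_top[of x]] mono)
  show "\<eta>l \<le> \<eta> x"
    by (rule tendsto_upperbound[OF lim_bot])
      (auto intro: eventually_mono[OF eventually_le_at_bot[of x]] mono)
qed

lemma B_nonneg: "0 \<le> B"
  using decay[of 1] nonneg[of 1] by simp

lemma cont: "continuous_on UNIV \<eta>"
  using deriv1 by (meson DERIV_isCont continuous_at_imp_continuous_on)

lemma meas [measurable]: "\<eta> \<in> borel_measurable borel"
  using cont by (rule borel_measurable_continuous_onI)

text \<open>The two summands serve the trivial bound \<open>\<eta>r - \<eta>l\<close> for
  \<open>x < 1\<close> and the bound \<open>B / x\<close> for \<open>x >= 1\<close>. The factor 2
  pays for \<open>1 + x <= 2\<close> and \<open>1 + x <= 2 * x\<close> respectively.\<close>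

definition K where "K = 2 * (\<eta>r - \<eta>l + B)"

lemma K_nonneg: "0 \<le> K"
  using bounds[of 0] B_nonneg by (simp add: K_def)

text \<open>Merges two bounds into one on the whole half-line. The rate \<open>1 / (1 + x)\<close>
  is deliberately weakened: its antiderivative would be a logarithm, whereas
  \<open>1 / sqrt (1 + x)\<close> integrates to a square root, still integrable against
  \<open>1 / y^2\<close> at infinity.\<close>

lemma le_K_over_sqrt:
  assumes "0 \<le> x" "d \<le> \<eta>r - \<eta>l" "x \<ge> 1 \<Longrightarrow> d \<le> B / x"
  shows "d \<le> K / sqrt (1 + x)"
proof -
  have "sqrt (1 + x) * sqrt (1 + x) \<ge> sqrt (1 + x) * 1"
    using assms(1) by (intro mult_left_mono) auto
  then have s: "sqrt (1 + x) \<le> 1 + x" "0 < sqrt (1 + x)" using assms(1) by auto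
  have M: "0 \<le> \<eta>r - \<eta>l" using bounds[of 0] by simp
  have "d \<le> K / (1 + x)"
  proof (cases "x \<ge> 1")
    case True
    then have "d \<le> B / x" by (rule assms)
    also have "\<dots> \<le> K / (1 + x)"
    proof -
      have "B * (1 + x) \<le> B * (2 * x)" using True B_nonneg by (intro mult_left_mono) auto
      also have "\<dots> \<le> K * x" using M True by (simp add: K_def algebra_simps mult_right_mono)
      finally show ?thesis using True by (simp add: field_simps)
    qed
    finally show ?thesis .
  next
    case False
    have "d * (1 + x) \<le> (\<eta>r - \<eta>l) * 2"
      using False assms M
      by (intro order_trans[OF mult_right_mono mult_left_mono]) auto
    also have "\<dots> \<le> K" using B_nonneg by (simp add: K_def)
    finally show ?thesis using assms(1) by (simp add: field_simps)
  qed
  also have "\<dots> \<le> K / sqrt (1 + x)"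
    using s K_nonneg assms(1) by (intro divide_left_mono) auto
  finally show ?thesis .
qed

lemma dist_limit_top:
  assumes "0 \<le> x" shows "\<bar>\<eta> x - \<eta>r\<bar> \<le> K / sqrt (1 + x)"
proof -
  have "\<eta>r - \<eta> x \<le> B / x" if "x \<ge> 1"
    by (rule tail_le_inverse[OF deriv1 _ lim_top that]) (use decay in auto)
  then show ?thesis using bounds[of x] assms by (simp add: le_K_over_sqrt)
qed

text \<open>The reflection \<open>- \<eta> (- x)\<close> is again nondecreasing and turns the left
  tail into a right tail. The minus signs are kept because \<open>- \<eta> (- x)\<close> is the
  derivative of \<open>\<Phi> (- x)\<close> for an antiderivative \<open>\<Phi>\<close> of
  \<open>\<eta>\<close>.\<close>

lemma dist_limit_bot:
  assumes "0 \<le> x" shows "\<bar>- \<eta> (- x) - (- \<eta>l)\<bar> \<le> K / sqrt (1 + x)"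
proof -
  have "- \<eta>l - (- \<eta> (- x)) \<le> B / x" if "x \<ge> 1"
  proof (rule tail_le_inverse[OF _ _ _ that])
    show "((\<lambda>x. - \<eta> (- x)) has_real_derivative \<eta>' (- x)) (at x)" for x
      by (auto intro!: derivative_eq_intros DERIV_chain2[OF deriv1])
    show "\<eta>' (- x) \<le> B / x\<^sup>2" if "1 \<le> x" for x using decay[of "- x"] that by simp
    show "((\<lambda>x. - \<eta> (- x)) \<longlongrightarrow> - \<eta>l) at_top"
      by (intro tendsto_minus filterlim_compose[OF lim_bot] filterlim_uminus_at_bot_at_top)
  qed
  then show ?thesis using bounds[of "- x"] assms by (simp add: le_K_over_sqrt)
qed

section \<open>Second differences of an antiderivative of the front\<close>

lemma antiderivative_asymptotics_front:
  assumes \<Phi>: "\<And>x. (\<Phi> has_real_derivative \<eta> x) (at x)" and x: "0 \<le> x"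
  shows "\<bar>\<Phi> x - \<Phi> 0 - \<eta>r * x\<bar> \<le> 2 * K * sqrt (1 + x)"
    and "\<bar>\<Phi> (- x) - \<Phi> 0 + \<eta>l * x\<bar> \<le> 2 * K * sqrt (1 + x)"
proof -
  show "\<bar>\<Phi> x - \<Phi> 0 - \<eta>r * x\<bar> \<le> 2 * K * sqrt (1 + x)"
    by (rule antiderivative_asymptotics[OF \<Phi> dist_limit_top x])
  have "((\<lambda>x. \<Phi> (- x)) has_real_derivative - \<eta> (- x)) (at x)" for x
    using DERIV_chain2[OF \<Phi> DERIV_minus[OF DERIV_ident], of x] by simp
  from antiderivative_asymptotics[OF this dist_limit_bot x]
  show "\<bar>\<Phi> (- x) - \<Phi> 0 + \<eta>l * x\<bar> \<le> 2 * K * sqrt (1 + x)" by simp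
qed

text \<open>Between \<open>z - y\<close> and \<open>z + y\<close> every point has modulus at least
  \<open>R / 2 >= 1\<close>, so the decay assumption applies there and gives
  \<open>\<eta>' <= B / (R / 2)^2\<close>.\<close>

lemma second_difference_near:
  assumes \<Phi>: "\<And>x. (\<Phi> has_real_derivative \<eta> x) (at x)"
    and R: "2 \<le> R" and z: "\<bar>z\<bar> = R" and y: "0 \<le> y" "y \<le> R / 2"
  shows "\<bar>\<Phi> (z + y) - 2 * \<Phi> z + \<Phi> (z - y)\<bar> \<le> 4 * B / R\<^sup>2 * y\<^sup>2"
proof (rule second_difference_le[OF \<Phi> deriv1 y(1)])
  fix t assume "z - y \<le> t" "t \<le> z + y"
  then have t: "R / 2 \<le> \<bar>t\<bar>" using z y by linarith
  have "\<eta>' t \<le> B / t\<^sup>2" using t R by (intro decay) linarith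
  also have "\<dots> = B / \<bar>t\<bar>\<^sup>2" by simp
  also have "\<dots> \<le> B / (R / 2)\<^sup>2"
    using t R B_nonneg by (intro divide_left_mono power_mono mult_pos_pos zero_less_power) auto
  also have "\<dots> = 4 * B / R\<^sup>2" by (simp add: power2_eq_square)
  finally show "\<bar>\<eta>' t\<bar> \<le> 4 * B / R\<^sup>2" using nonneg[of t] by simp
qed

text \<open>The piecewise linear leading part of \<open>\<Phi>\<close> is the sum of a linear and an even function,
  so it does not contribute to the difference of second differences at \<open>R\<close> and \<open>-R\<close>.\<close>

lemma second_difference_far:
  assumes \<Phi>: "\<And>x. (\<Phi> has_real_derivative \<eta> x) (at x)"
    and R: "2 \<le> R" and y: "R / 2 \<le> y"
  shows "\<bar>(\<Phi> (R + y) - 2 * \<Phi> R + \<Phi> (R - y)) - (\<Phi> (- R + y) - 2 * \<Phi> (- R) + \<Phi> (- R - y))\<bar>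
    \<le> 32 * K * sqrt y"
proof -
  define L where "L = (\<lambda>z. if 0 \<le> z then \<eta>r * z else \<eta>l * z)"
  define E where "E = (\<lambda>z. \<Phi> z - \<Phi> 0 - L z)"
  have E: "\<bar>E z\<bar> \<le> 4 * K * sqrt y" if z: "\<bar>z\<bar> \<le> R + y" for z
  proof -
    have "\<bar>E z\<bar> \<le> 2 * K * sqrt (1 + \<bar>z\<bar>)"
      using antiderivative_asymptotics_front(1)[OF \<Phi>, of z]
        antiderivative_asymptotics_front(2)[OF \<Phi>, of "- z"]
      by (auto simp: E_def L_def)
    \<comment> \<open>Since \<open>R <= 2 * y\<close> and \<open>1 <= R / 2 <= y\<close>, one has
      \<open>1 + \<bar>z\<bar> <= 1 + R + y <= 4 * y\<close>.\<close>
    also have "\<dots> \<le> 2 * K * sqrt (2\<^sup>2 * y)"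
      using z R y K_nonneg by (intro mult_left_mono real_sqrt_le_mono) auto
    finally show ?thesis by (simp add: real_sqrt_mult)
  qed
  have "(L (R + y) - 2 * L R + L (R - y)) - (L (- R + y) - 2 * L (- R) + L (- R - y)) = 0"
    using R y by (auto simp: L_def algebra_simps)
  then have "(\<Phi> (R + y) - 2 * \<Phi> R + \<Phi> (R - y)) - (\<Phi> (- R + y) - 2 * \<Phi> (- R) + \<Phi> (- R - y))
    = (E (R + y) - 2 * E R + E (R - y)) - (E (- R + y) - 2 * E (- R) + E (- R - y))"
    by (simp add: E_def)
  \<comment> \<open>The weights 1, 2, 1 at both ends add up to 8, whence
    \<open>32 * K\<close>.\<close>
  moreover have "\<bar>E (R + y)\<bar> \<le> 4 * K * sqrt y" "\<bar>E R\<bar> \<le> 4 * K * sqrt y"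
    "\<bar>E (R - y)\<bar> \<le> 4 * K * sqrt y" "\<bar>E (- R + y)\<bar> \<le> 4 * K * sqrt y"
    "\<bar>E (- R)\<bar> \<le> 4 * K * sqrt y" "\<bar>E (- R - y)\<bar> \<le> 4 * K * sqrt y"
    using R y by (intro E; linarith)+
  ultimately show ?thesis by linarith
qed

section \<open>Fubini for the singular integral\<close>

text \<open>For \<open>x\<close> in \<open>[-R, R]\<close> the kernel has a majorant
  \<open>g\<close> independent of \<open>x\<close>: the bound on \<open>\<eta>''\<close> controls it
  for \<open>y < 1\<close>, boundedness of \<open>\<eta>\<close> for \<open>y >= 1\<close>. Each
  slice is then integrable, and the integrals of the norms are bounded on a compact
  interval.\<close>

lemma kernel_integrable:
  "integrable (lborel \<Otimes>\<^sub>M lborel) (\<lambda>(x, y). indicator {-R..R} x *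
     (indicator {0<..} y * ((\<eta> (x + y) - 2 * \<eta> x + \<eta> (x - y)) / y\<^sup>2)))"
    (is "integrable _ (\<lambda>(x, y). indicator {-R..R} x * ?q x y)")
proof -
  \<comment> \<open>The margin 1 leaves room for the shifts \<open>x + y\<close> and
    \<open>x - y\<close> with \<open>0 < y < 1\<close>.\<close>
  have "compact (\<eta>'' ` {-R-1..R+1})"
    by (intro compact_continuous_image continuous_on_subset[OF cont2]) auto
  then obtain S where "\<And>t. t \<in> \<eta>'' ` {-R-1..R+1} \<Longrightarrow> \<bar>t\<bar> \<le> S"
    by (metis bounded_real compact_imp_bounded)
  then have S: "\<bar>\<eta>'' t\<bar> \<le> S" if "-R-1 \<le> t" "t \<le> R+1" for t using that by auto
  define M where "M = 2 * (\<eta>r - \<eta>l)"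
  define g where "g = (\<lambda>y. S * indicator {0<..<1} y + M * (y powr (-2) * indicator {1..} y))"
  have g: "integrable lborel g"
    using has_bochner_integral_const_powr_tail[of 1 2 S M]
    by (simp add: has_bochner_integral_iff g_def)
  have q: "\<bar>?q x y\<bar> \<le> g y" if x: "x \<in> {-R..R}" for x y
  proof -
    consider "y \<le> 0" | "0 < y" "y < 1" | "1 \<le> y" by linarith
    then show ?thesis
    proof cases
      case 2
      have "\<bar>\<eta> (x + y) - 2 * \<eta> x + \<eta> (x - y)\<bar> \<le> S * y\<^sup>2"
        using x 2 by (intro second_difference_le[OF deriv1 deriv2] S) auto
      with 2 show ?thesis by (simp add: g_def field_simps)
    next
      case 3
      have "\<bar>\<eta> (x + y) - 2 * \<eta> x + \<eta> (x - y)\<bar> \<le> M"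
        using bounds[of x] bounds[of "x + y"] bounds[of "x - y"] by (simp add: M_def abs_le_iff)
      with 3 show ?thesis
        by (simp add: g_def powr_minus powr_numeral field_simps)
    qed (simp add: g_def)
  qed
  have meas_q [measurable]:
    "(\<lambda>(x, y). indicator {-R..R} x * ?q x y) \<in> borel_measurable (lborel \<Otimes>\<^sub>M lborel)"
    by measurable
  have slice: "integrable lborel (\<lambda>y. indicator {-R..R} x * ?q x y)" for x
  proof (rule Bochner_Integration.integrable_bound[OF g])
    have "norm (indicator {-R..R} x * ?q x y) \<le> norm (g y)" for y
      using order_trans[OF q abs_ge_self, of x y] by (cases "x \<in> {-R..R}") 
        (simp_all del: times_divide_eq_right)
    then show "AE y in lborel. norm (indicator {-R..R} x * ?q x y) \<le> norm (g y)" by simp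
  qed measurable
  show ?thesis
  proof (rule lborel_pair.Fubini_integrable[OF meas_q])
    show "AE x in lborel. integrable lborel
        (\<lambda>y. case (x, y) of (x, y) \<Rightarrow> indicator {-R..R} x * ?q x y)"
      using slice by simp
    have "integrable lborel (\<lambda>x. indicator {-R..R} x * integral\<^sup>L lborel g)"
      by (intro integrable_mult_left integrable_real_indicator)
        (auto simp: emeasure_lborel_Icc_eq)
    then show "integrable lborel
        (\<lambda>x. \<integral>y. norm (case (x, y) of (x, y) \<Rightarrow> indicator {-R..R} x * ?q x y) \<partial>lborel)"
    proof (rule Bochner_Integration.integrable_bound)
      have "norm (\<integral>y. norm (indicator {-R..R} x * ?q x y) \<partial>lborel)
          \<le> norm (indicator {-R..R} x * integral\<^sup>L lborel g)" for x
      proof (cases "x \<in> {-R..R}")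
        case True
        then have "(\<integral>y. \<bar>?q x y\<bar> \<partial>lborel) \<le> integral\<^sup>L lborel g"
          using q g by (intro integral_mono' order_trans[OF abs_ge_zero q]) blast+
        then have "\<bar>\<integral>y. \<bar>?q x y\<bar> \<partial>lborel\<bar> \<le> \<bar>integral\<^sup>L lborel g\<bar>"
          by (simp del: times_divide_eq_right)
        then show ?thesis using True by (simp del: times_divide_eq_right)
      qed simp
      then show "AE x in lborel. norm (\<integral>y. norm (case (x, y) of (x, y) \<Rightarrow>
          indicator {-R..R} x * ?q x y) \<partial>lborel) \<le> norm (indicator {-R..R} x * integral\<^sup>L lborel g)"
        by simp
    qed measurable
  qed
qed

text \<open>After exchanging the integrals, the inner one over \<open>x\<close> is evaluated by the
  fundamental theorem: the second difference of \<open>\<Phi>\<close> in \<open>x\<close> is an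
  antiderivative of that of \<open>\<eta>\<close>.\<close>

lemma integral_abs_deriv:
  assumes \<Phi>: "\<And>x. (\<Phi> has_real_derivative \<eta> x) (at x)" and R: "0 \<le> R"
  shows "(LBINT x:{-R..R}. abs_deriv \<eta> x) = - (1 / pi) * (LBINT y:{0<..}.
    ((\<Phi> (R + y) - 2 * \<Phi> R + \<Phi> (R - y)) - (\<Phi> (- R + y) - 2 * \<Phi> (- R) + \<Phi> (- R - y))) / y\<^sup>2)"
proof -
  let ?q = "\<lambda>x y. (\<eta> (x + y) - 2 * \<eta> x + \<eta> (x - y)) / y\<^sup>2"
  have "(LBINT x:{-R..R}. abs_deriv \<eta> x)
      = - (1 / pi) * (\<integral>x. (\<integral>y. indicator {-R..R} x * (indicator {0<..} y * ?q x y) \<partial>lborel) \<partial>lborel)"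
    unfolding abs_deriv_def set_integral_mult_right
    by (simp only: set_lebesgue_integral_def real_scaleR_def integral_mult_right_zero)
  also have "(\<integral>x. (\<integral>y. indicator {-R..R} x * (indicator {0<..} y * ?q x y) \<partial>lborel) \<partial>lborel)
      = (\<integral>y. (\<integral>x. indicator {-R..R} x * (indicator {0<..} y * ?q x y) \<partial>lborel) \<partial>lborel)"
    by (rule lborel_pair.Fubini_integral[OF kernel_integrable, symmetric])
  also have "\<dots> = (\<integral>y. indicator {0<..} y * (\<integral>x. ?q x y * indicator {-R..R} x \<partial>lborel) \<partial>lborel)"
    by (intro Bochner_Integration.integral_cong refl, subst integral_mult_right_zero[symmetric])
      (intro Bochner_Integration.integral_cong refl, simp)
  also have "\<dots> = (\<integral>y. indicator {0<..} y *
      (((\<Phi> (R + y) - 2 * \<Phi> R + \<Phi> (R - y)) - (\<Phi> (- R + y) - 2 * \<Phi> (- R) + \<Phi> (- R - y))) / y\<^sup>2) \<partial>lborel)"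
  proof (intro Bochner_Integration.integral_cong refl)
    \<comment> \<open>No case distinction on \<open>y\<close>: at \<open>y = 0\<close> division by
      zero makes both sides 0.\<close>
    fix y :: real
    have "(\<integral>x. ?q x y * indicator {-R..R} x \<partial>lborel)
      = (\<Phi> (R + y) - 2 * \<Phi> R + \<Phi> (R - y)) / y\<^sup>2 - (\<Phi> (- R + y) - 2 * \<Phi> (- R) + \<Phi> (- R - y)) / y\<^sup>2"
    proof (rule integral_FTC_Icc_real)
      fix x
      have "((\<lambda>x. \<Phi> (x + y) - 2 * \<Phi> x + \<Phi> (x - y)) has_real_derivative
          (\<eta> (x + y) - 2 * \<eta> x + \<eta> (x - y))) (at x)"
        by (auto intro!: derivative_eq_intros DERIV_chain2[OF \<Phi>] \<Phi>)
      then show "((\<lambda>x. (\<Phi> (x + y) - 2 * \<Phi> x + \<Phi> (x - y)) / y\<^sup>2) has_real_derivative ?q x y) (at x)"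
        by (rule DERIV_cdivide)
      have "((\<lambda>x. \<eta> (x + y) - 2 * \<eta> x + \<eta> (x - y)) has_real_derivative
          (\<eta>' (x + y) - 2 * \<eta>' x + \<eta>' (x - y))) (at x)"
        by (auto intro!: derivative_eq_intros DERIV_chain2[OF deriv1] deriv1)
      then have "((\<lambda>x. ?q x y) has_real_derivative
          (\<eta>' (x + y) - 2 * \<eta>' x + \<eta>' (x - y)) / y\<^sup>2) (at x)"
        by (rule DERIV_cdivide)
      then show "isCont (\<lambda>x. ?q x y) x" by (rule DERIV_isCont)
    qed (use R in simp)
    then show "indicator {0<..} y * (\<integral>x. ?q x y * indicator {-R..R} x \<partial>lborel)
      = indicator {0<..} y *
      (((\<Phi> (R + y) - 2 * \<Phi> R + \<Phi> (R - y)) - (\<Phi> (- R + y) - 2 * \<Phi> (- R) + \<Phi> (- R - y))) / y\<^sup>2)"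
      by (simp add: diff_divide_distrib)
  qed
  finally show ?thesis by (simp add: set_lebesgue_integral_def)
qed

section \<open>Vanishing of the nonlocal term\<close>

lemma integral_abs_deriv_le:
  assumes R: "2 \<le> R"
  shows "\<bar>LBINT x:{-R..R}. abs_deriv \<eta> x\<bar> \<le> (4 * B / R + 64 * K * (R / 2) powr - (1 / 2)) / pi"
proof -
  obtain \<Phi> where \<Phi>: "\<And>x. (\<Phi> has_real_derivative \<eta> x) (at x)"
    using antiderivative_exists[OF cont] by blast
  define G where
    "G = (\<lambda>y. (\<Phi> (R + y) - 2 * \<Phi> R + \<Phi> (R - y)) - (\<Phi> (- R + y) - 2 * \<Phi> (- R) + \<Phi> (- R - y)))"
  \<comment> \<open>The constant 8 comes from two near estimates with \<open>4 * B / R^2\<close>,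
    and integrates over length \<open>R / 2\<close> to \<open>4 * B / R\<close>. The exponent is
    \<open>1 / 2 - 2\<close>, from \<open>sqrt y / y^2\<close>; this tail integrates to
    \<open>64 * K * (R / 2) powr - (1 / 2)\<close>.\<close>
  define g where "g = (\<lambda>y. 8 * B / R\<^sup>2 * indicator {0<..<R / 2} y
      + 32 * K * (y powr - (3 / 2) * indicator {R / 2..} y))"
  have g: "has_bochner_integral lborel g (8 * B / R\<^sup>2 * (R / 2)
      + 32 * K * ((R / 2) powr (1 - 3 / 2) / (3 / 2 - 1)))"
    unfolding g_def using R by (intro has_bochner_integral_const_powr_tail) auto
  have G: "\<bar>indicator {0<..} y * (G y / y\<^sup>2)\<bar> \<le> g y" for y
  proof -
    consider "y \<le> 0" | "0 < y" "y < R / 2" | "R / 2 \<le> y" by linarith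
    then show ?thesis
    proof cases
      case 1
      then show ?thesis using R by (simp add: g_def)
    next
      case 2
      then have "\<bar>G y\<bar> \<le> 8 * B / R\<^sup>2 * y\<^sup>2"
        using second_difference_near[OF \<Phi> R, of R y] second_difference_near[OF \<Phi> R, of "- R" y] R
        unfolding G_def by auto
      with 2 show ?thesis by (simp add: g_def pos_divide_le_eq)
    next
      case 3
      have y: "0 < y" using 3 R by linarith
      have "\<bar>G y\<bar> \<le> 32 * K * sqrt y"
        using second_difference_far[OF \<Phi> R 3] by (simp add: G_def)
      also have "sqrt y = y powr - (3 / 2) * y\<^sup>2"
      proof -
        have "y powr - (3 / 2) * y\<^sup>2 = y powr - (3 / 2) * y powr 2" using y by simp
        also have "\<dots> = y powr (1 / 2)" by (simp flip: powr_add)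
        finally show ?thesis using y by (simp add: powr_half_sqrt)
      qed
      finally show ?thesis using 3 y by (simp add: g_def pos_divide_le_eq mult.assoc)
    qed
  qed
  have "\<bar>LBINT y:{0<..}. G y / y\<^sup>2\<bar> \<le> (\<integral>y. \<bar>indicator {0<..} y * (G y / y\<^sup>2)\<bar> \<partial>lborel)"
    unfolding set_lebesgue_integral_def by (simp only: real_scaleR_def integral_abs_bound)
  also have "\<dots> \<le> integral\<^sup>L lborel g"
    using g G by (intro integral_mono' order_trans[OF abs_ge_zero G])
      (auto simp: has_bochner_integral_iff)
  also have "\<dots> = 4 * B / R + 64 * K * (R / 2) powr - (1 / 2)"
    using g R by (simp add: has_bochner_integral_iff power2_eq_square field_simps)
  finally show ?thesis
    using R unfolding integral_abs_deriv[OF \<Phi>, of R, OF order_trans[OF _ R], simplified] G_def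
    by (simp add: abs_mult divide_right_mono)
qed

lemma integral_abs_deriv_tendsto_0: "((\<lambda>R. LBINT x:{-R..R}. abs_deriv \<eta> x) \<longlongrightarrow> 0) at_top"
proof (rule Lim_null_comparison)
  show "eventually (\<lambda>R. norm (LBINT x:{-R..R}. abs_deriv \<eta> x)
      \<le> (4 * B / R + 64 * K * (R / 2) powr - (1 / 2)) / pi) at_top"
    by (rule eventually_mono[OF eventually_ge_at_top[of 2]]) (simp add: integral_abs_deriv_le)
  show "((\<lambda>R. (4 * B / R + 64 * K * (R / 2) powr - (1 / 2)) / pi) \<longlongrightarrow> 0) at_top"
    by real_asymp
qed

end

section \<open>The formula for the speed\<close>

theorem proposition1p2:
  fixes \<eta>l \<eta>r c A B :: real and F \<eta> :: "real \<Rightarrow> real"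
  assumes "\<eta>l < \<eta>r"
    and "Ck 3 F"
    and "deriv F \<eta>l = 0" and "deriv F \<eta>r = 0"
    and "deriv (deriv F) \<eta>l > 0" and "deriv (deriv F) \<eta>r > 0"
    and "Ck 2 \<eta>"
    and "mono \<eta>"
    and "\<And>x. deriv \<eta> x > 0"
    and "\<And>x. - abs_deriv \<eta> x + c * deriv \<eta> x = deriv F (\<eta> x)"
    and "(\<eta> \<longlongrightarrow> \<eta>l) at_bot"
    and "(\<eta> \<longlongrightarrow> \<eta>r) at_top"
    and "0 < A" and "A < B"
    and "\<And>x. \<bar>x\<bar> \<ge> 1 \<Longrightarrow> A * \<bar>x\<bar> powi (-2) \<le> deriv \<eta> x"
    and "\<And>x. \<bar>x\<bar> \<ge> 1 \<Longrightarrow> deriv \<eta> x \<le> B * \<bar>x\<bar> powi (-2)"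
  shows "\<exists>L. ((\<lambda>R. LBINT x:{-R..R}. deriv F (\<eta> x)) \<longlongrightarrow> L) at_top \<and>
             c = 1 / (\<eta>r - \<eta>l) * L"
proof -
  have F: "deriv F field_differentiable at x" for x
    using assms(2) by (force simp: Ck_def dest: spec[of _ 1])
  have \<eta>: "(\<eta> has_real_derivative deriv \<eta> x) (at x)" for x
    using assms(7) by (force simp: Ck_def DERIV_deriv_iff_field_differentiable dest: spec[of _ 0])
  have \<eta>': "(deriv \<eta> has_real_derivative deriv (deriv \<eta>) x) (at x)" for x
    using assms(7) by (force simp: Ck_def DERIV_deriv_iff_field_differentiable dest: spec[of _ 1])
  interpret front \<eta> "deriv \<eta>" "deriv (deriv \<eta>)" \<eta>l \<eta>r B
  proof
    show "continuous_on UNIV (deriv (deriv \<eta>))"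
      using assms(7) by (simp add: Ck_def numeral_2_eq_2)
    show "deriv \<eta> x \<le> B / x\<^sup>2" if "1 \<le> \<bar>x\<bar>" for x
      using assms(16)[OF that] by (simp add: power_int_minus field_simps)
  qed (use \<eta> \<eta>' assms in \<open>auto intro: less_imp_le\<close>)
  have cont': "continuous_on UNIV (deriv \<eta>)"
    using \<eta>' by (meson DERIV_isCont continuous_at_imp_continuous_on)
  have "continuous_on UNIV (deriv F)"
    using F by (meson field_differentiable_imp_continuous_at continuous_at_imp_continuous_on)
  then have cF: "continuous_on UNIV (\<lambda>x. deriv F (\<eta> x))"
    by (rule continuous_on_compose2) (use cont in auto)
  \<comment> \<open>The equation exhibits \<open>abs_deriv \<eta>\<close> as a difference of two
    continuous functions, so its integral over \<open>[-R, R]\<close> splits.\<close>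
  have abs_deriv_eq: "abs_deriv \<eta> = (\<lambda>x. c * deriv \<eta> x - deriv F (\<eta> x))"
    using assms(10) by (auto simp: fun_eq_iff algebra_simps)
  have "(LBINT x:{-R..R}. deriv F (\<eta> x)) = c * (\<eta> R - \<eta> (- R)) - (LBINT x:{-R..R}. abs_deriv \<eta> x)"
    if R: "0 \<le> R" for R
  proof -
    have int: "set_integrable lborel {-R..R} (\<lambda>x. c * deriv \<eta> x)"
      "set_integrable lborel {-R..R} (\<lambda>x. deriv F (\<eta> x))"
      by (intro borel_integrable_atLeastAtMost' continuous_intros
          continuous_on_subset[OF cont'] continuous_on_subset[OF cF]; simp)+
    have "(LBINT x:{-R..R}. deriv \<eta> x) = \<eta> R - \<eta> (- R)"
      unfolding set_lebesgue_integral_def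
      using R \<eta> by (intro integral_FTC_atLeastAtMost continuous_on_subset[OF cont'])
        (auto simp: has_real_derivative_iff_has_vector_derivative
          intro: has_vector_derivative_at_within)
    then show ?thesis by (simp add: abs_deriv_eq set_integral_diff[OF int])
  qed
  \<comment> \<open>The identity is available for \<open>R >= 0\<close> only, so the limit is
    transferred through eventual equality.\<close>
  then have "eventually (\<lambda>R. c * (\<eta> R - \<eta> (- R)) - (LBINT x:{-R..R}. abs_deriv \<eta> x)
      = (LBINT x:{-R..R}. deriv F (\<eta> x))) at_top"
    by (intro eventually_mono[OF eventually_ge_at_top[of 0]]) simp
  moreover have "((\<lambda>R. c * (\<eta> R - \<eta> (- R)) - (LBINT x:{-R..R}. abs_deriv \<eta> x))
      \<longlongrightarrow> c * (\<eta>r - \<eta>l) - 0) at_top"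
    by (intro tendsto_intros lim_top filterlim_compose[OF lim_bot]
        filterlim_uminus_at_bot_at_top integral_abs_deriv_tendsto_0)
  ultimately have "((\<lambda>R. LBINT x:{-R..R}. deriv F (\<eta> x)) \<longlongrightarrow> c * (\<eta>r - \<eta>l) - 0) at_top"
    by (rule Lim_transform_eventually[rotated])
  then show ?thesis
    using assms(1) by (intro exI[of _ "c * (\<eta>r - \<eta>l)"]) (simp add: field_simps)
qed

end
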